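(* For every integer $n\ge 1$, $$\mathrm{pf}_n(123,312)=2\binom{n+1}{3}+1.$$
   Context: A Dyck path of semilength $n$ is a lattice path from $(0,0)$ to $(n,n)$ consisting of $n$ north steps $N=(0,1)$ and $n$ east steps $E=(1,0)$ that never goes below the line $y=x$. A parking function of size $n$ is a Dyck path of semilength $n$ whose $n$ north steps are labeled bijectively by $\{1,\dots,n\}$ so that whenever two north steps are consecutive in the path (one immediately following the other), the label of the later one is larger. For a parking function $p$ of size $n$, $\phi(p)$ is the permutation of $\{1,\dots,n\}$ (in one-line notation) obtained by reading the labels of the north steps in the order they occur along the path. A permutation $\pi$ of $\{1,\dots,n\}$ contains a permutation $\rho$ of $\{1,\dots,m\}$ if there are indices $1\le i_1<\cdots<i_m\le n$ such that $\pi_{i_a}\le\pi_{i_b}$ if and only if $\rho_a\le\rho_b$; otherwise $\pi$ avoids $\rho$. For permutations $\rho_1,\dots,\rho_r$, $\mathrm{pf}_n(\rho_1,\dots,\rho_r)$ denotes the number of parking functions $p$ of size $n$ such that $\phi(p)$ avoids each of $\rho_1,\dots,\rho_r$. Binomial coefficients $\binom{a}{b}$ with $0\le a<b$ are $0$. *)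

theory Defs
  imports Main
begin

datatype step = North | East

definition dyck_path :: "nat \<Rightarrow> step list \<Rightarrow> bool" where
  "dyck_path n w \<longleftrightarrow>
     count_list w North = n \<and> count_list w East = n \<and>
     (\<forall>k\<le>length w. count_list (take k w) East \<le> count_list (take k w) North)"

text \<open>
  A labelled path is a list of steps whose north steps carry their labels;
  \<open>unlabel\<close> recovers the underlying lattice step.
\<close>

datatype labelled_step = is_N: N (label: nat) | E

primrec unlabel :: "labelled_step \<Rightarrow> step" where
  "unlabel (N a) = North"
| "unlabel E = East"

definition parking_function :: "nat \<Rightarrow> labelled_step list \<Rightarrow> bool" where
  "parking_function n p \<longleftrightarrow>
     dyck_path n (map unlabel p) \<and>
     bij_betw (\<lambda>i. label (p ! i)) {i. i < length p \<and> is_N (p ! i)} {1..n} \<and>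
     (\<forall>i. Suc i < length p \<and> is_N (p ! i) \<and> is_N (p ! Suc i)
            \<longrightarrow> label (p ! i) < label (p ! Suc i))"

definition phi :: "labelled_step list \<Rightarrow> nat list" where
  "phi p = map label (filter is_N p)"

text \<open>
  Permutations are lists in one-line notation. The indices \<open>i\<^sub>1 < \<dots> < i\<^sub>m\<close> of an
  occurrence are given by a strictly increasing function; list positions start at 0.
\<close>

definition contains :: "nat list \<Rightarrow> nat list \<Rightarrow> bool" where
  "contains \<pi> \<rho> \<longleftrightarrow>
     (\<exists>f. strict_mono_on {..<length \<rho>} f \<and> f ` {..<length \<rho>} \<subseteq> {..<length \<pi>} \<and>
        (\<forall>a<length \<rho>. \<forall>b<length \<rho>. \<pi> ! f a \<le> \<pi> ! f b \<longleftrightarrow> \<rho> ! a \<le> \<rho> ! b))"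

abbreviation avoids :: "nat list \<Rightarrow> nat list \<Rightarrow> bool" where
  "avoids \<pi> \<rho> \<equiv> \<not> contains \<pi> \<rho>"

definition pf :: "nat \<Rightarrow> nat list set \<Rightarrow> nat" where
  "pf n R = card {p. parking_function n p \<and> (\<forall>\<rho>\<in>R. avoids (phi p) \<rho>)}"

lemma length_unlabelled:
  "length w = count_list w North + count_list w East"
proof (induction w)
  case (Cons s w)
  then show ?case by (cases s) auto
qed simp

text \<open>The cardinality in \<open>pf\<close> is that of a finite set.\<close>

lemma finite_parking_functions: "finite {p. parking_function n p}"
proof (rule finite_subset)
  let ?A = "insert E (N ` {1..n})"
  show "{p. parking_function n p} \<subseteq> {p. set p \<subseteq> ?A \<and> length p = 2 * n}"
  proof clarify
    fix p assume p: "parking_function n p"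
    have len: "length p = 2 * n"
      using p length_unlabelled[of "map unlabel p"]
      by (simp add: parking_function_def dyck_path_def)
    have "x \<in> ?A" if "x \<in> set p" for x
    proof (cases x)
      case (N a)
      obtain i where i: "i < length p" "p ! i = x"
        using \<open>x \<in> set p\<close> unfolding in_set_conv_nth by blast
      have "bij_betw (\<lambda>i. label (p ! i)) {i. i < length p \<and> is_N (p ! i)} {1..n}"
        using p by (simp add: parking_function_def)
      moreover have "i \<in> {i. i < length p \<and> is_N (p ! i)}"
        using i N by simp
      ultimately have "label (p ! i) \<in> {1..n}"
        by (rule bij_betw_apply)
      then show ?thesis using i N by auto
    qed simp
    then show "set p \<subseteq> ?A \<and> length p = 2 * n" using len by blast
  qed
  show "finite {p. set p \<subseteq> ?A \<and> length p = 2 * n}"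
    by (rule finite_lists_length_eq) simp
qed

end

theory Submission
  imports Defs
begin

text \<open>
  Cut a permutation avoiding 123 and 312 at its maximum, as \<open>\<alpha> n \<beta>\<close>. Avoiding 123 makes \<open>\<alpha>\<close>
  decreasing, avoiding 312 makes \<open>\<beta>\<close> decreasing and the values of \<open>\<alpha>\<close> an interval \<open>{a..b}\<close>.
  Every descent of the word forces an east step, so the path is the staircase, except that at the
  only ascent, in front of \<open>n\<close>, the east step may be postponed to any of the \<open>n - \<bar>\<alpha>\<bar>\<close> later
  positions. An interval \<open>{a..b}\<close> thus contributes \<open>n - b + a\<close> parking functions, and the
  decreasing permutation contributes one more.
\<close>

section \<open>Counting the parking functions with a given reading word\<close>

text \<open>
  Here \<open>h\<close> is the excess of north over east steps read so far, and \<open>l\<close> is the label of the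
  previous step if that step is a north step, and 0 otherwise.
\<close>

fun valid_from :: "nat \<Rightarrow> nat \<Rightarrow> labelled_step list \<Rightarrow> bool" where
  "valid_from h l [] \<longleftrightarrow> h = 0"
| "valid_from h l (N a # p) \<longleftrightarrow> l < a \<and> valid_from (Suc h) a p"
| "valid_from h l (E # p) \<longleftrightarrow> h > 0 \<and> valid_from (h - 1) 0 p"

lemma all_le_Suc_split: "(\<forall>k\<le>Suc n. P k) \<longleftrightarrow> P 0 \<and> (\<forall>k\<le>n. P (Suc k))"
  using All_less_Suc2[of "Suc n" P] by (simp add: less_Suc_eq_le)

lemma phi_simps [simp]:
  "phi [] = []" "phi (N a # p) = a # phi p" "phi (E # p) = phi p"
  by (simp_all add: phi_def)

lemma label_hd_in_phi: "p \<noteq> [] \<Longrightarrow> is_N (hd p) \<Longrightarrow> label (hd p) \<in> set (phi p)"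
  by (cases p) (simp_all add: phi_def)

text \<open>Links the recursion to the definition of a parking function: reading starts at height
  \<open>h\<close>, so counts of north steps are shifted by \<open>h\<close>. Labels must be nonzero
  because \<open>l = 0\<close> has to impose no condition on the next label.\<close>

lemma valid_from_iff:
  assumes "0 \<notin> set (phi p)"
  shows "valid_from h l p \<longleftrightarrow>
     count_list (map unlabel p) East = count_list (map unlabel p) North + h \<and>
     (\<forall>k\<le>length p. count_list (take k (map unlabel p)) East
        \<le> count_list (take k (map unlabel p)) North + h) \<and>
     successively (\<lambda>x y. is_N x \<and> is_N y \<longrightarrow> label x < label y) p \<and>
     (p \<noteq> [] \<longrightarrow> is_N (hd p) \<longrightarrow> l < label (hd p))"
  using assms
proof (induction h l p rule: valid_from.induct)
  case (2 h l a p)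
  then show ?case
    by (auto simp: all_le_Suc_split successively_Cons)
next
  case (3 h l p)
  show ?case
  proof (cases h)
    case 0
    \<comment> \<open>The prefix consisting of this east step alone violates the inequality.\<close>
    then show ?thesis
      by (auto simp: all_le_Suc_split dest: spec[of _ 0])
  next
    case (Suc h')
    \<comment> \<open>After the east step \<open>l\<close> is reset to 0; if a north step follows,
      its label occurs in \<open>phi p\<close> and is therefore positive.\<close>
    with 3 show ?thesis
      using label_hd_in_phi[of p]
      by (auto simp: all_le_Suc_split successively_Cons)
  qed
qed auto

lemma count_North_eq_length_phi: "count_list (map unlabel p) North = length (phi p)"
proof (induction p)
  case (Cons x p)
  then show ?case by (cases x) auto
qed simp

text \<open>The index set has \<open>length (phi p)\<close> elements and its image is
  \<open>set (phi p)\<close>, so injectivity amounts to distinctness.\<close>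

lemma bij_betw_labels_iff:
  "bij_betw (\<lambda>i. label (p ! i)) {i. i < length p \<and> is_N (p ! i)} A
     \<longleftrightarrow> distinct (phi p) \<and> set (phi p) = A"
proof -
  let ?I = "{i. i < length p \<and> is_N (p ! i)}"
  have img: "(\<lambda>i. label (p ! i)) ` ?I = set (phi p)"
    by (auto simp: phi_def in_set_conv_nth image_iff)
  have "inj_on (\<lambda>i. label (p ! i)) ?I \<longleftrightarrow> card (set (phi p)) = card ?I"
    unfolding img[symmetric] by (rule inj_on_iff_eq_card) simp
  moreover have "card ?I = length (phi p)"
    by (simp add: phi_def length_filter_conv_card)
  ultimately show ?thesis
    unfolding bij_betw_def img using card_distinct distinct_card by metis
qed

text \<open>The final height 0 balances the two kinds of steps, and the distinct labels fix their
  number as \<open>n\<close>.\<close>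

lemma parking_function_iff:
  "parking_function n p \<longleftrightarrow>
     valid_from 0 0 p \<and> distinct (phi p) \<and> set (phi p) = {1..n}"
proof -
  have len: "length (phi p) = n" if "distinct (phi p)" "set (phi p) = {1..n}"
    using distinct_card[OF that(1)] that(2) by simp
  show ?thesis
  proof (cases "set (phi p) = {1..n}")
    case True
    then have "0 \<notin> set (phi p)" by simp
    with True show ?thesis
      unfolding parking_function_def dyck_path_def bij_betw_labels_iff valid_from_iff[OF \<open>0 \<notin> set (phi p)\<close>]
        successively_conv_nth count_North_eq_length_phi
      using len label_hd_in_phi[of p] by auto
  qed (simp add: parking_function_def bij_betw_labels_iff)
qed

text \<open>These are the fibres of \<open>phi\<close>, with an arbitrary starting state so that
  they satisfy a recursion on the first step.\<close>

definition labellings :: "nat \<Rightarrow> nat \<Rightarrow> nat list \<Rightarrow> labelled_step list set" where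
  "labellings h l w = {p. valid_from h l p \<and> phi p = w}"

lemma labellings_Nil_0: "labellings 0 l [] = {[]}"
proof -
  have "p = []" if "valid_from 0 l p" "phi p = []" for p
    using that by (cases "(0::nat, l, p)" rule: valid_from.cases) auto
  then show ?thesis by (auto simp: labellings_def)
qed

lemma labellings_Nil_Suc: "labellings (Suc h) l [] = (#) E ` labellings h 0 []"
proof -
  have "p \<in> (#) E ` labellings h 0 []" if "valid_from (Suc h) l p" "phi p = []" for p
    using that by (cases "(Suc h, l, p)" rule: valid_from.cases) (auto simp: labellings_def)
  then show ?thesis by (auto simp: labellings_def)
qed

lemma labellings_Cons:
  "labellings h l (a # w) =
     (if l < a then (#) (N a) ` labellings (Suc h) a w else {}) \<union>
     (if h > 0 then (#) E ` labellings (h - 1) 0 (a # w) else {})" (is "?A = ?B")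
proof
  show "?A \<subseteq> ?B"
  proof
    fix p assume "p \<in> ?A"
    then show "p \<in> ?B"
      by (cases "(h, l, p)" rule: valid_from.cases) (auto simp: labellings_def)
  qed
  show "?B \<subseteq> ?A" by (auto simp: labellings_def)
qed

lemma finite_labellings [simp]: "finite (labellings h l w)"
proof (induction w arbitrary: h l)
  case Nil
  show ?case
    by (induction h arbitrary: l) (simp_all add: labellings_Nil_0 labellings_Nil_Suc)
next
  case (Cons a w)
  \<comment> \<open>An east step keeps the word and lowers \<open>h\<close>, hence the inner
    induction.\<close>
  show ?case
    by (induction h arbitrary: l) (simp_all add: labellings_Cons[of _ _ a] Cons)
qed

section \<open>Numbers of paths for words with at most one ascent\<close>

lemma card_labellings_Nil: "card (labellings h l []) = 1"
  by (induction h arbitrary: l) (simp_all add: labellings_Nil_0 labellings_Nil_Suc card_image)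

lemma card_labellings_Cons:
  "card (labellings h l (a # w)) =
     (if l < a then card (labellings (Suc h) a w) else 0) +
     (if h > 0 then card (labellings (h - 1) 0 (a # w)) else 0)"
  unfolding labellings_Cons[of h]
  by (subst card_Un_disjoint) (auto simp: card_image)

text \<open>Split by the height \<open>0\<close> or \<open>Suc h\<close>, the recursion is usable
  for rewriting: every recursive call consumes a letter or lowers the height.\<close>

lemma card_labellings_0_Cons:
  "card (labellings 0 l (a # w)) = (if l < a then card (labellings (Suc 0) a w) else 0)"
  by (simp add: card_labellings_Cons)

lemma card_labellings_Suc_Cons:
  "card (labellings (Suc h) l (a # w)) =
     (if l < a then card (labellings (Suc (Suc h)) a w) else 0) + card (labellings h 0 (a # w))"
  unfolding card_labellings_Cons[of "Suc h"] by simp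

text \<open>At each descent an east step is forced; it brings the height to 0, where the next step
  has to go north.\<close>

lemma card_labellings_decreasing:
  assumes "sorted_wrt (>) (l # w)" "0 \<notin> set w"
  shows "card (labellings (Suc 0) l w) = 1"
  using assms
proof (induction w arbitrary: l)
  case (Cons a w)
  then show ?case
    by (simp add: card_labellings_0_Cons card_labellings_Suc_Cons)
qed (simp add: card_labellings_Nil)

text \<open>The surplus east step is spent in front of some letter of \<open>w\<close> or after the
  last one. Spending it leaves the rigid case of height 1, keeping it leaves the same problem for
  the tail.\<close>

lemma card_labellings_decreasing_postponed:
  assumes "sorted_wrt (>) (l # w)" "0 \<notin> set w"
  shows "card (labellings (Suc (Suc 0)) l w) = Suc (length w)"
  using assms
proof (induction w arbitrary: l)
  case (Cons a w)
  then show ?case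
    by (simp add: card_labellings_0_Cons card_labellings_Suc_Cons card_labellings_decreasing)
qed (simp add: card_labellings_Nil)

text \<open>All steps before the ascent are forced. There, an east step before \<open>c\<close>
  leaves one way to continue, and \<open>c\<close> placed directly leaves
  \<open>length w + 1\<close> ways.\<close>

lemma card_labellings_one_ascent_aux:
  assumes "sorted_wrt (>) (l # v)" "0 \<notin> set v" "\<forall>x\<in>set (l # v). x < c"
    "sorted_wrt (>) (c # w)" "0 \<notin> set w"
  shows "card (labellings (Suc 0) l (v @ c # w)) = length w + 2"
  using assms
proof (induction v arbitrary: l)
  case Nil
  then show ?case
    by (simp add: card_labellings_0_Cons card_labellings_Suc_Cons
        card_labellings_decreasing card_labellings_decreasing_postponed)
next
  case (Cons a v)
  then show ?case
    by (simp add: card_labellings_0_Cons card_labellings_Suc_Cons)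
qed

lemma card_labellings_one_ascent:
  assumes "sorted_wrt (>) v" "v \<noteq> []" "0 \<notin> set v" "\<forall>x\<in>set v. x < c"
    "sorted_wrt (>) (c # w)" "0 \<notin> set w"
  shows "card (labellings 0 0 (v @ c # w)) = length w + 2"
proof (cases v)
  case (Cons a v')
  then show ?thesis
    using assms card_labellings_one_ascent_aux[of a v' c w]
    by (simp add: card_labellings_0_Cons)
qed (use assms in simp)

section \<open>Permutations avoiding 123 and 312\<close>

lemma strict_mono_on_lessThan_3:
  fixes f :: "nat \<Rightarrow> nat"
  shows "strict_mono_on {..<3} f \<longleftrightarrow> f 0 < f 1 \<and> f 1 < f 2"
proof
  show "f 0 < f 1 \<and> f 1 < f 2" if "strict_mono_on {..<3} f"
    using that by (auto simp: strict_mono_on_def)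
  show "strict_mono_on {..<3} f" if "f 0 < f 1 \<and> f 1 < f 2"
    using that by (auto simp: strict_mono_on_def numeral_3_eq_3 less_Suc_eq numeral_2_eq_2)
qed

text \<open>Of the nine comparisons in \<open>contains\<close>, the three of a position with itself
  hold trivially.\<close>

lemma contains_length_3_iff:
  "contains w [x, y, z] \<longleftrightarrow>
     (\<exists>i j k. i < j \<and> j < k \<and> k < length w \<and>
        (w ! i \<le> w ! j \<longleftrightarrow> x \<le> y) \<and> (w ! j \<le> w ! i \<longleftrightarrow> y \<le> x) \<and>
        (w ! i \<le> w ! k \<longleftrightarrow> x \<le> z) \<and> (w ! k \<le> w ! i \<longleftrightarrow> z \<le> x) \<and>
        (w ! j \<le> w ! k \<longleftrightarrow> y \<le> z) \<and> (w ! k \<le> w ! j \<longleftrightarrow> z \<le> y))" (is "?L \<longleftrightarrow> ?R")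
proof
  have all3: "(\<forall>a<3. P a) \<longleftrightarrow> P 0 \<and> P 1 \<and> P 2" for P :: "nat \<Rightarrow> bool"
    by (auto simp: numeral_3_eq_3 less_Suc_eq numeral_2_eq_2)
  have len: "length [x, y, z] = 3" by simp
  show ?R if ?L
  proof -
    obtain f where f: "f 0 < f 1" "f 1 < f 2" "f ` {..<3} \<subseteq> {..<length w}"
      and "\<forall>a<3. \<forall>b<3. w ! f a \<le> w ! f b \<longleftrightarrow> [x, y, z] ! a \<le> [x, y, z] ! b"
      using \<open>?L\<close> unfolding contains_def len strict_mono_on_lessThan_3 by blast
    then have *: "w ! f a \<le> w ! f b \<longleftrightarrow> [x, y, z] ! a \<le> [x, y, z] ! b" if "a < 3" "b < 3" for a b
      using that by blast
    have "f 2 < length w" using f(3) image_subset_iff[of f] by simp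
    with f(1,2) show ?R
      using *[of 0 1] *[of 1 0] *[of 0 2] *[of 2 0] *[of 1 2] *[of 2 1]
      by (intro exI[of _ "f 0"] exI[of _ "f 1"] exI[of _ "f 2"] conjI) simp_all
  qed
  show ?L if ?R
  proof -
    obtain i j k where *: "i < j" "j < k" "k < length w"
      "w ! i \<le> w ! j \<longleftrightarrow> x \<le> y" "w ! j \<le> w ! i \<longleftrightarrow> y \<le> x"
      "w ! i \<le> w ! k \<longleftrightarrow> x \<le> z" "w ! k \<le> w ! i \<longleftrightarrow> z \<le> x"
      "w ! j \<le> w ! k \<longleftrightarrow> y \<le> z" "w ! k \<le> w ! j \<longleftrightarrow> z \<le> y"
      using \<open>?R\<close> by blast
    show ?L
      unfolding contains_def len strict_mono_on_lessThan_3 all3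
      using * by (intro exI[of _ "\<lambda>a. [i, j, k] ! a"] conjI)
        (simp_all add: numeral_3_eq_3 lessThan_Suc numeral_2_eq_2)
  qed
qed

lemma contains_123_iff:
  "contains w [1, 2, 3] \<longleftrightarrow>
     (\<exists>i j k. i < j \<and> j < k \<and> k < length w \<and> w ! i < w ! j \<and> w ! j < w ! k)"
  unfolding contains_length_3_iff by (intro ex_cong1) auto

lemma contains_312_iff:
  "contains w [3, 1, 2] \<longleftrightarrow>
     (\<exists>i j k. i < j \<and> j < k \<and> k < length w \<and> w ! j < w ! k \<and> w ! k < w ! i)"
  unfolding contains_length_3_iff by (intro ex_cong1) auto

text \<open>A decreasing block contains no ascent, so the two positions lie in different
  blocks.\<close>

lemma ascent_in_append_decreasing:
  fixes v w :: "nat list"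
  assumes "sorted_wrt (>) v" "sorted_wrt (>) w"
    and "i < j" "j < length (v @ w)" "(v @ w) ! i < (v @ w) ! j"
  shows "i < length v \<and> length v \<le> j"
proof (rule ccontr)
  assume "\<not> ?thesis"
  then consider "j < length v" | "length v \<le> i" by linarith
  then show False
  proof cases
    case 1
    then show False
      using assms sorted_wrt_nth_less[OF assms(1) \<open>i < j\<close>] by (simp add: nth_append)
  next
    case 2
    then have "i - length v < j - length v" "j - length v < length w"
      using assms(3,4) by simp_all
    with 2 show False
      using assms sorted_wrt_nth_less[OF assms(2), of "i - length v" "j - length v"]
      by (simp add: nth_append)
  qed
qed

lemma avoids_append_decreasing:
  fixes v w :: "nat list"
  assumes v: "sorted_wrt (>) v" and w: "sorted_wrt (>) w"
    and interval: "set v = {a..b}" and disj: "set v \<inter> set w = {}"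
  shows "avoids (v @ w) [1, 2, 3]" "avoids (v @ w) [3, 1, 2]"
proof -
  note asc = ascent_in_append_decreasing[OF v w]
  \<comment> \<open>The middle entry would end one ascent, hence lie in \<open>w\<close>, and start
    another, hence lie in \<open>v\<close>.\<close>
  show "avoids (v @ w) [1, 2, 3]"
    unfolding contains_123_iff using asc by (metis less_trans not_le)
  show "avoids (v @ w) [3, 1, 2]"
  proof
    assume "contains (v @ w) [3, 1, 2]"
    then obtain i j k where ijk: "i < j" "j < k" "k < length (v @ w)"
      "(v @ w) ! j < (v @ w) ! k" "(v @ w) ! k < (v @ w) ! i"
      unfolding contains_312_iff by blast
    have jk: "j < length v" "length v \<le> k" using asc ijk by blast+
    \<comment> \<open>The entry at \<open>k\<close> lies between two values of \<open>v\<close>, so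
      the interval forces its value into \<open>set v\<close> although its position is in
      \<open>w\<close>.\<close>
    have "v ! i \<in> {a..b}" "v ! j \<in> {a..b}"
      using jk ijk unfolding interval[symmetric] by auto
    then have "(v @ w) ! k \<in> set v"
      unfolding interval using ijk jk by (auto simp: nth_append)
    moreover have "(v @ w) ! k \<in> set w"
      using jk ijk by (auto simp: nth_append)
    ultimately show False using disj by blast
  qed
qed

text \<open>Reversed, both words are the increasing enumeration of the same set.\<close>

lemma decreasing_unique:
  fixes v w :: "nat list"
  assumes "sorted_wrt (>) v" "sorted_wrt (>) w" "set v = set w"
  shows "v = w"
proof -
  have "sorted_wrt (<) (rev v)" "sorted_wrt (<) (rev w)"
    using assms by (simp_all add: sorted_wrt_rev)
  then have "rev v = rev w"
    using assms(3) by (intro sorted_distinct_set_unique) (auto simp: strict_sorted_iff)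
  then show ?thesis by simp
qed

section \<open>Explicit list of the permutations avoiding both patterns\<close>

lemma decreasing_upt: "sorted_wrt (>) (rev [i..<j])"
  by (simp add: sorted_wrt_rev)

text \<open>Normal form of the avoiding permutations that do not begin with their maximum. For
  \<open>1 \<le> a \<le> b < n\<close> the two runs after \<open>n\<close> make up the complement of
  the interval in \<open>{1..<n}\<close>, and their order keeps the tail decreasing.\<close>

definition interval_perm :: "nat \<Rightarrow> nat \<Rightarrow> nat \<Rightarrow> nat list" where
  "interval_perm n a b = rev [a..<Suc b] @ n # rev [Suc b..<n] @ rev [1..<a]"

definition good_perms :: "nat \<Rightarrow> nat list set" where
  "good_perms n = {w. distinct w \<and> set w = {1..n} \<and> avoids w [1, 2, 3] \<and> avoids w [3, 1, 2]}"

lemma decreasing_interval_perm_tail: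
  assumes "a \<le> b" "b < n"
  shows "sorted_wrt (>) (n # rev [Suc b..<n] @ rev [1..<a])"
  using assms by (auto simp: sorted_wrt_append sorted_wrt_rev)

lemma interval_perm_in_good_perms:
  assumes "1 \<le> a" "a \<le> b" "b < n"
  shows "interval_perm n a b \<in> good_perms n"
proof -
  have "set (rev [a..<Suc b]) = {a..b}" by auto
  moreover have "set (rev [a..<Suc b]) \<inter> set (n # rev [Suc b..<n] @ rev [1..<a]) = {}"
    using assms by auto
  ultimately have "avoids (interval_perm n a b) [1, 2, 3]" "avoids (interval_perm n a b) [3, 1, 2]"
    unfolding interval_perm_def
    by (rule avoids_append_decreasing[OF decreasing_upt decreasing_interval_perm_tail[OF assms(2,3)]])+
  moreover have "distinct (interval_perm n a b)" "set (interval_perm n a b) = {1..n}"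
    using assms by (auto simp: interval_perm_def)
  ultimately show ?thesis
    by (simp add: good_perms_def)
qed

lemma rev_upt_in_good_perms: "rev [1..<Suc n] \<in> good_perms n"
proof -
  \<comment> \<open>The decreasing word is the case of an empty first block, whose value set is an
    empty interval.\<close>
  have "set [] = {1..0::nat}" "set [] \<inter> set (rev [1..<Suc n]) = {}" by simp_all
  from avoids_append_decreasing[OF _ decreasing_upt this]
  show ?thesis unfolding good_perms_def by auto
qed

lemma good_perms_cases:
  assumes "w \<in> good_perms n" "n \<ge> 1"
  obtains "w = rev [1..<Suc n]"
  | a b where "1 \<le> a" "a \<le> b" "b < n" "w = interval_perm n a b"
proof -
  have w: "distinct w" "set w = {1..n}"
    and no123: "\<And>i j k. \<lbrakk>i < j; j < k; k < length w; w ! i < w ! j; w ! j < w ! k\<rbrakk> \<Longrightarrow> False"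
    and no312: "\<And>i j k. \<lbrakk>i < j; j < k; k < length w; w ! j < w ! k; w ! k < w ! i\<rbrakk> \<Longrightarrow> False"
    using assms(1) unfolding good_perms_def contains_123_iff contains_312_iff by blast+
  obtain u v where uv: "w = u @ n # v"
    using w assms(2) split_list[of n w] by auto
  have less_n: "x < n" if "x \<in> set u \<union> set v" for x
  proof -
    have "x \<le> n" "x \<noteq> n" using that w unfolding uv by auto
    then show ?thesis by simp
  qed
  \<comment> \<open>An ascent inside \<open>u\<close>, followed by \<open>n\<close>, would be a
    123.\<close>
  have u: "sorted_wrt (>) u"
    unfolding sorted_wrt_iff_nth_less
  proof (intro allI impI)
    fix i j assume ij: "i < j" "j < length u"
    then have "\<not> u ! i < u ! j"
      using no123[of i j "length u"] less_n[of "u ! j"] by (auto simp: uv nth_append)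
    moreover have "u ! i \<noteq> u ! j"
      using ij w(1) by (auto simp: uv nth_eq_iff_index_eq)
    ultimately show "u ! j < u ! i" by simp
  qed
  \<comment> \<open>An ascent inside \<open>v\<close>, preceded by \<open>n\<close>, would be a
    312.\<close>
  have v: "sorted_wrt (>) v"
    unfolding sorted_wrt_iff_nth_less
  proof (intro allI impI)
    fix i j assume ij: "i < j" "j < length v"
    then have "\<not> v ! i < v ! j"
      using no312[of "length u" "Suc (length u + i)" "Suc (length u + j)"] less_n[of "v ! j"]
      by (auto simp: uv nth_append)
    moreover have "v ! i \<noteq> v ! j"
      using ij w(1) by (auto simp: uv nth_eq_iff_index_eq)
    ultimately show "v ! j < v ! i" by simp
  qed
  show thesis
  proof (cases "u = []")
    case True
    have "sorted_wrt (>) w" using True v less_n by (auto simp: uv)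
    moreover have "set w = set (rev [1..<Suc n])"
      by (simp add: w(2) atLeastLessThanSuc_atLeastAtMost del: upt_Suc)
    ultimately have "w = rev [1..<Suc n]"
      by (rule decreasing_unique[OF _ decreasing_upt])
    then show thesis by (rule that(1))
  next
    case False
    \<comment> \<open>Since \<open>u\<close> is decreasing, these are its minimum and
      maximum.\<close>
    define a b where "a = last u" and "b = hd u"
    have ab: "a \<in> set u" "b \<in> set u"
      using False by (simp_all add: a_def b_def)
    have b_max: "x \<le> b" if "x \<in> set u" for x
      using u that unfolding b_def by (cases u) auto
    have a_min: "a \<le> x" if "x \<in> set u" for x
      using u that unfolding a_def by (cases u rule: rev_cases) (auto simp: sorted_wrt_append)
    \<comment> \<open>A value skipped by \<open>u\<close> occurs in \<open>v\<close>, and then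
      \<open>b\<close>, \<open>a\<close>, \<open>x\<close> appear in this order as a 312.\<close>
    have between: "x \<in> set u" if "a < x" "x < b" for x
    proof (rule ccontr)
      assume "x \<notin> set u"
      have "x \<in> set w"
        using that less_n[of b] ab unfolding w(2) by auto
      then have "x \<in> set v"
        using \<open>x \<notin> set u\<close> that less_n[of b] ab unfolding uv by auto
      then obtain k where k: "k < length v" "v ! k = x"
        by (auto simp: in_set_conv_nth)
      have "w ! 0 = b" "w ! (length u - 1) = a" "w ! Suc (length u + k) = x"
        using False k by (simp_all add: uv nth_append a_def b_def hd_conv_nth last_conv_nth)
      \<comment> \<open>Otherwise \<open>u\<close> has a single entry and \<open>a = b\<close>,
        contrary to \<open>a < x < b\<close>.\<close>
      moreover have "0 < length u - 1"
        using calculation that by (cases "length u - 1") auto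
      moreover have "length u - 1 < Suc (length u + k)" "Suc (length u + k) < length w"
        using k by (simp_all add: uv)
      ultimately show False
        using no312[of 0 "length u - 1" "Suc (length u + k)"] that by simp
    qed
    have set_u: "set u = {a..b}"
    proof (intro equalityI subsetI)
      fix x assume "x \<in> {a..b}"
      then have "x = a \<or> x = b \<or> a < x \<and> x < b" by auto
      then show "x \<in> set u" using ab between by blast
    qed (simp add: a_min b_max)
    have "a \<in> set w" using ab by (simp add: uv)
    then have bounds: "1 \<le> a" "a \<le> b" "b < n"
      using ab a_min[of b] less_n[of b] w(2) by simp_all
    have "set v = set w - {n} - set u"
      using w(1) by (auto simp: uv)
    also have "\<dots> = set (rev [Suc b..<n] @ rev [1..<a])"
    proof (rule set_eqI)
      fix x
      show "x \<in> set w - {n} - set u \<longleftrightarrow> x \<in> set (rev [Suc b..<n] @ rev [1..<a])"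
        unfolding w(2) set_u using bounds by (simp, linarith)
    qed
    finally have set_v: "set v = set (rev [Suc b..<n] @ rev [1..<a])" .
    have "set u = set (rev [a..<Suc b])"
      by (simp add: set_u atLeastLessThanSuc_atLeastAtMost del: upt_Suc)
    then have "u = rev [a..<Suc b]"
      by (rule decreasing_unique[OF u decreasing_upt])
    moreover have "sorted_wrt (>) (rev [Suc b..<n] @ rev [1..<a])"
      using decreasing_interval_perm_tail[OF bounds(2,3)] by simp
    then have "v = rev [Suc b..<n] @ rev [1..<a]"
      using set_v by (rule decreasing_unique[OF v])
    ultimately have "w = interval_perm n a b"
      unfolding uv interval_perm_def by simp
    with bounds show thesis by (rule that(2))
  qed
qed

text \<open>Pairs are written \<open>(b, a)\<close> because the range of \<open>a\<close> depends on
  \<open>b\<close>, which later turns the sum into an iterated one.\<close>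

lemma good_perms_eq:
  assumes "n \<ge> 1"
  shows "good_perms n =
    insert (rev [1..<Suc n]) ((\<lambda>(b, a). interval_perm n a b) ` (SIGMA b:{1..<n}. {1..b}))"
proof -
  have "w \<in> insert (rev [1..<Suc n]) ((\<lambda>(b, a). interval_perm n a b) ` (SIGMA b:{1..<n}. {1..b}))"
    if "w \<in> good_perms n" for w
    using that assms
  proof (cases rule: good_perms_cases)
    case (2 a b)
    then show ?thesis by (intro insertI2 image_eqI[of _ _ "(b, a)"]) auto
  qed blast
  moreover have "interval_perm n a b \<in> good_perms n" if "b \<in> {1..<n}" "a \<in> {1..b}" for a b
    using that by (intro interval_perm_in_good_perms) auto
  ultimately show ?thesis
    using rev_upt_in_good_perms[of n] by (intro equalityI subsetI) (auto simp del: upt_Suc)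
qed

text \<open>Cutting at \<open>n\<close> recovers the interval from the word, which yields
  injectivity.\<close>

lemma takeWhile_interval_perm:
  assumes "b < n"
  shows "takeWhile (\<lambda>x. x \<noteq> n) (interval_perm n a b) = rev [a..<Suc b]"
proof -
  have "takeWhile (\<lambda>x. x \<noteq> n) (rev [a..<Suc b]) = rev [a..<Suc b]"
    using assms by (subst takeWhile_eq_all_conv) auto
  then show ?thesis
    unfolding interval_perm_def using assms by (subst takeWhile_append2) auto
qed

lemma inj_on_interval_perm:
  "inj_on (\<lambda>(b, a). interval_perm n a b) (SIGMA b:{1..<n}. {1..b})"
proof (rule inj_onI, clarify)
  fix b a b' a'
  assume *: "b \<in> {1..<n}" "a \<in> {1..b}" "b' \<in> {1..<n}" "a' \<in> {1..b'}"
    "interval_perm n a b = interval_perm n a' b'"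
  then have "rev [a..<Suc b] = rev [a'..<Suc b']"
    using takeWhile_interval_perm[of b n a] takeWhile_interval_perm[of b' n a']
    by (simp del: upt_Suc)
  then have "set (rev [a..<Suc b]) = set (rev [a'..<Suc b'])"
    by (rule arg_cong)
  then have "{a..b} = {a'..b'}"
    by (simp add: atLeastLessThanSuc_atLeastAtMost del: upt_Suc)
  with * show "b = b' \<and> a = a'" by auto
qed

lemma interval_perm_neq_rev_upt:
  assumes "b < n" "a \<le> b"
  shows "interval_perm n a b \<noteq> rev [1..<Suc n]"
proof
  assume "interval_perm n a b = rev [1..<Suc n]"
  \<comment> \<open>The two words begin with \<open>b\<close> and with \<open>n\<close>.\<close>
  then have "hd (interval_perm n a b) = hd (rev [1..<Suc n])" by simp
  with assms show False by (simp add: interval_perm_def)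
qed

section \<open>The total\<close>

lemma card_labellings_interval_perm:
  assumes "1 \<le> a" "a \<le> b" "b < n"
  shows "card (labellings 0 0 (interval_perm n a b)) = n - b + a"
proof -
  \<comment> \<open>The tail after \<open>n\<close> has \<open>(n - 1 - b) + (a - 1)\<close>
    entries, and the 2 cancels both losses.\<close>
  have "card (labellings 0 0 (interval_perm n a b)) =
      length (rev [Suc b..<n] @ rev [1..<a]) + 2"
    unfolding interval_perm_def using assms
    by (intro card_labellings_one_ascent decreasing_upt decreasing_interval_perm_tail) auto
  with assms show ?thesis by simp
qed

lemma card_labellings_rev_upt:
  assumes "n \<ge> 1"
  shows "card (labellings 0 0 (rev [1..<Suc n])) = 1"
proof -
  have "sorted_wrt (>) (n # rev [1..<n])"
    using decreasing_upt[of 1 "Suc n"] assms by simp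
  then have "card (labellings (Suc 0) n (rev [1..<n])) = 1"
    by (rule card_labellings_decreasing) simp
  with assms show ?thesis by (simp add: card_labellings_0_Cons)
qed

text \<open>Parking functions are sorted by reading word; different words have disjoint
  fibres.\<close>

lemma pf_eq_sum:
  "pf n {[1, 2, 3], [3, 1, 2]} = (\<Sum>w\<in>good_perms n. card (labellings 0 0 w))"
proof -
  have "finite (good_perms n)"
    by (rule finite_subset[OF _ finite_subset_distinct[of "{1..n}"]]) (auto simp: good_perms_def)
  moreover have "\<forall>w\<in>good_perms n. \<forall>w'\<in>good_perms n.
      w \<noteq> w' \<longrightarrow> labellings 0 0 w \<inter> labellings 0 0 w' = {}"
    by (auto simp: labellings_def)
  moreover have "{p. parking_function n p \<and> (\<forall>\<rho>\<in>{[1, 2, 3], [3, 1, 2]}. avoids (phi p) \<rho>)} =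
      (\<Union>w\<in>good_perms n. labellings 0 0 w)"
    by (auto simp: parking_function_iff good_perms_def labellings_def)
  ultimately show ?thesis
    unfolding pf_def by (simp add: card_UN_disjoint)
qed

text \<open>The inner sum splits into \<open>b * (n - b)\<close> and \<open>Suc b choose 2\<close>;
  summed over \<open>b\<close>, each part gives \<open>Suc n choose 3\<close>, whence the factor
  2.\<close>

lemma sum_weights:
  "(\<Sum>b = 1..<n. \<Sum>a = 1..b. n - b + a) = 2 * ((n + 1) choose 3)"
proof -
  have inner: "(\<Sum>a = 1..b. n - b + a) = b * (n - b) + (Suc b choose 2)" for b
    using gauss_sum_from_Suc_0[of b, where 'a = nat]
    by (simp add: sum.distrib choose_two mult.commute)
  have A: "(\<Sum>b = 1..<n. Suc b choose 2) = Suc n choose 3" for n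
    by (induction n) (auto simp: numeral_3_eq_3 numeral_2_eq_2)
  have lin: "(\<Sum>b = 1..<n. b) = n choose 2" for n
    by (induction n) (auto simp: numeral_2_eq_2)
  have B: "(\<Sum>b = 1..<n. b * (n - b)) = Suc n choose 3" for n
  proof (induction n)
    case (Suc n)
    have "(\<Sum>b = 1..<Suc n. b * (Suc n - b)) = (\<Sum>b = 1..<Suc n. b * (n - b) + b)"
      by (intro sum.cong) (auto simp: Suc_diff_le)
    \<comment> \<open>The product vanishes at \<open>b = n\<close>, so its range shrinks; the added
      terms \<open>b\<close> sum to a binomial coefficient and Pascal's rule finishes.\<close>
    also have "\<dots> = (\<Sum>b = 1..<n. b * (n - b)) + (Suc n choose 2)"
      unfolding sum.distrib lin by (cases n) auto
    also have "\<dots> = Suc (Suc n) choose 3"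
      unfolding Suc by (simp add: numeral_3_eq_3 numeral_2_eq_2)
    finally show ?case .
  qed (simp add: numeral_3_eq_3)
  show ?thesis
    unfolding inner unfolding sum.distrib A B by simp
qed

theorem theorem19:
  fixes n :: nat
  assumes "n \<ge> 1"
  shows "pf n {[1, 2, 3], [3, 1, 2]} = 2 * ((n + 1) choose 3) + 1"
proof -
  let ?S = "SIGMA b:{1..<n}. {1..b}" and ?f = "\<lambda>(b, a). interval_perm n a b"
  let ?c = "\<lambda>w. card (labellings 0 0 w)"
  have "rev [1..<Suc n] \<notin> ?f ` ?S"
    using interval_perm_neq_rev_upt[symmetric] by (auto simp del: upt_Suc)
  then have "pf n {[1, 2, 3], [3, 1, 2]} = 1 + sum ?c (?f ` ?S)"
    unfolding pf_eq_sum good_perms_eq[OF assms]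
    by (subst sum.insert) (simp_all only: card_labellings_rev_upt[OF assms], auto)
  also have "sum ?c (?f ` ?S) = (\<Sum>(b, a)\<in>?S. n - b + a)"
    unfolding sum.reindex[OF inj_on_interval_perm]
    by (intro sum.cong) (auto simp: card_labellings_interval_perm)
  also have "\<dots> = (\<Sum>b = 1..<n. \<Sum>a = 1..b. n - b + a)"
    by (subst sum.Sigma) auto
  finally show ?thesis
    unfolding sum_weights by simp
qed

end
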